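(* For every integer $n\geq 2$ and every odd positive integer $k<n$, there is a set $\Omega$ of nonzero $n$-tuples over $\{0,1\}$ such that $NEPS(P_{3},\ldots,P_{3};\Omega)$ ($n$ factors) is connected and exhibits perfect state transfer (between some pair of distinct vertices) at time $\tau_{k}=\pi/(\sqrt{2})^{k}$.
   Context: $P_{3}$ is the path with vertices $1,2,3$ where $1$ and $3$ are adjacent to $2$. For a set $\Omega$ of nonzero $n$-tuples $\beta\in\{0,1\}^{n}$, $NEPS(P_{3},\ldots,P_{3};\Omega)$ has vertex set $\{1,2,3\}^{n}$, and $(x_{i})$, $(y_{i})$ are adjacent iff for some $\beta\in\Omega$, $x_{i}=y_{i}$ whenever $\beta_{i}=0$ and $x_{i}$ is adjacent to $y_{i}$ in $P_{3}$ whenever $\beta_{i}=1$. For a graph with adjacency matrix $A$, perfect state transfer from $u$ to $v$ at time $\tau$ means $|e_{u}^{T}\exp(-i\tau A)e_{v}|=1$. *)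

theory Defs
  imports "HOL-Analysis.Analysis" "Graph_Theory.Graph_Theory"
begin

text \<open>
  Undirected graphs are symmetric digraphs. The numeral type \<open>3\<close> has exactly the three elements
  \<open>1\<close>, \<open>2\<close> and \<open>3\<close> (with \<open>3 = 0\<close>), and the numeral type \<open>2\<close> has exactly the elements \<open>0\<close> and \<open>1\<close>.
\<close>

definition P3 :: "3 pair_pre_digraph" where
  "P3 = \<lparr>pverts = {1, 2, 3}, parcs = {(1, 2), (2, 1), (2, 3), (3, 2)}\<rparr>"

definition NEPS :: "('n \<Rightarrow> 'a pair_pre_digraph) \<Rightarrow> (2 ^ 'n) set \<Rightarrow> ('a ^ 'n) pair_pre_digraph" where
  "NEPS G \<Omega> =
    \<lparr>pverts = {x. \<forall>i. x $ i \<in> pverts (G i)},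
     parcs = {(x, y). (\<forall>i. x $ i \<in> pverts (G i) \<and> y $ i \<in> pverts (G i)) \<and>
       (\<exists>\<beta>\<in>\<Omega>. \<forall>i. (\<beta> $ i = 0 \<longrightarrow> x $ i = y $ i) \<and>
                     (\<beta> $ i = 1 \<longrightarrow> (x $ i, y $ i) \<in> parcs (G i)))}\<rparr>"

text \<open>
  Matrices are indexed by the whole vertex type; they are only meant for graphs whose vertex set is
  the whole type, such as \<open>P3\<close> and its NEPS.
\<close>

definition adjacency_matrix :: "'v::finite pair_pre_digraph \<Rightarrow> complex ^ 'v ^ 'v" where
  "adjacency_matrix G = (\<chi> u v. if (u, v) \<in> parcs G then 1 else 0)"

text \<open>
  The library's \<open>exp\<close> is not available for matrices, since \<open>*\<close> on type \<open>vec\<close> is componentwise;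
  hence the power series with respect to the matrix product \<open>**\<close>.
\<close>

definition matrix_exp :: "complex ^ 'v ^ 'v \<Rightarrow> complex ^ 'v ^ 'v" where
  "matrix_exp M = (\<Sum>m. ((\<lambda>X. M ** X) ^^ m) (mat 1) /\<^sub>R fact m)"

text \<open>The \<open>(u, v)\<close> entry of a matrix \<open>M\<close> is \<open>e\<^sub>u\<^sup>T M e\<^sub>v\<close>.\<close>

definition perfect_state_transfer ::
    "'v::finite pair_pre_digraph \<Rightarrow> 'v \<Rightarrow> 'v \<Rightarrow> real \<Rightarrow> bool" where
  "perfect_state_transfer G u v \<tau> \<longleftrightarrow>
    norm (matrix_exp (\<chi> x y. - \<i> * complex_of_real \<tau> * adjacency_matrix G $ x $ y) $ u $ v) = 1"

end

theory Submission
  imports Defs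
begin

text \<open>
  \<open>P3\<close> has eigenvalues \<open>\<surd>2 * t\<close> with \<open>t \<in> {-1, 0, 1}\<close>. If \<open>\<Omega>\<close> consists of the indicators of
  a family \<open>F\<close> of \<open>k\<close>-sets, then the products of eigenvectors of \<open>P3\<close> are eigenvectors of the NEPS
  with eigenvalues \<open>(\<surd>2)^k * m\<close> for the integers \<open>m = (\<Sum>S\<in>F. \<Prod>i\<in>S. t i)\<close>, so that at time
  \<open>\<pi> / (\<surd>2)^k\<close> they are multiplied by \<open>(-1)^m\<close>. Let \<open>u\<close> and \<open>v\<close> have all coordinates \<open>2\<close>,
  except for \<open>1\<close> and \<open>3\<close>, respectively, at \<open>j\<close>. Only eigenvectors without vanishing \<open>t i\<close>
  contribute to \<open>e\<^sub>u + e\<^sub>v\<close>, and only those with \<open>t i = 0\<close> exactly for \<open>i = j\<close> contribute to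
  \<open>e\<^sub>u - e\<^sub>v\<close>; hence these two vectors get opposite signs, and \<open>u\<close> is transferred to \<open>v\<close>,
  as soon as \<open>j\<close> lies in an odd number of members of \<open>F\<close>. An edge changes the set of coordinates
  equal to \<open>2\<close> by a member of \<open>F\<close>, and this set is the only obstruction to connectedness, so the
  NEPS is connected if \<open>F\<close> spans all sets under symmetric difference.
\<close>

section \<open>Eigenvectors of the matrix exponential\<close>

lemma vec_sumsI:
  fixes f :: "nat \<Rightarrow> 'a::real_normed_vector ^ 'n::finite"
  assumes "\<And>i. (\<lambda>m. f m $ i) sums (s $ i)"
  shows "f sums s"
  using assms unfolding sums_def by (intro vec_tendstoI) simp

lemma matrix_power_entry_bound:
  fixes M :: "complex ^ 'v::finite ^ 'v"
  assumes "\<And>i j. norm (M $ i $ j) \<le> c"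
  shows "norm (((\<lambda>X. M ** X) ^^ m) (mat 1) $ i $ j) \<le> (real CARD('v) * c) ^ m"
proof (induction m arbitrary: i j)
  case 0
  then show ?case by (simp add: mat_def)
next
  case (Suc m)
  let ?P = "((\<lambda>X. M ** X) ^^ m) (mat 1)"
  have "c \<ge> 0"
    using assms[of i j] norm_ge_zero[of "M $ i $ j"] by linarith
  have "norm ((M ** ?P) $ i $ j) \<le> (\<Sum>l\<in>UNIV. norm (M $ i $ l * ?P $ l $ j))"
    unfolding matrix_matrix_mult_def by (simp add: norm_sum)
  also have "\<dots> \<le> (\<Sum>l\<in>(UNIV::'v set). c * (real CARD('v) * c) ^ m)"
    unfolding norm_mult using Suc.IH assms \<open>c \<ge> 0\<close> by (intro sum_mono mult_mono) auto
  also have "\<dots> = (real CARD('v) * c) ^ Suc m"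
    by simp
  finally show ?case by simp
qed

text \<open>Comparison with the exponential series of \<open>CARD('v) * c\<close>, where
  \<open>c\<close> bounds the entries of \<open>M\<close>, makes every entry converge. Convergence
  in \<open>vec\<close> is componentwise, so the series in \<open>matrix_exp\<close> has a genuine
  limit that can be read off entry by entry.\<close>

lemma matrix_exp_entry_sums:
  fixes M :: "complex ^ 'v::finite ^ 'v"
  shows "(\<lambda>m. (((\<lambda>X. M ** X) ^^ m) (mat 1) /\<^sub>R fact m) $ u $ v) sums (matrix_exp M $ u $ v)"
proof -
  let ?f = "\<lambda>m. ((\<lambda>X. M ** X) ^^ m) (mat 1) /\<^sub>R fact m"
  obtain c where c: "\<And>i j. norm (M $ i $ j) \<le> c"
  proof
    fix i j
    show "norm (M $ i $ j) \<le> norm M"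
      using Finite_Cartesian_Product.norm_nth_le[of "M $ i" j] Finite_Cartesian_Product.norm_nth_le[of M i] by linarith
  qed
  have summable: "summable (\<lambda>m. ?f m $ i $ j)" for i j
  proof (rule summable_comparison_test')
    show "summable (\<lambda>m. (real CARD('v) * c) ^ m /\<^sub>R fact m)"
      by (rule summable_exp_generic)
    show "norm (?f m $ i $ j) \<le> (real CARD('v) * c) ^ m /\<^sub>R fact m" for m
      using matrix_power_entry_bound[OF c, of m i j] by (simp add: divide_simps)
  qed
  have "?f sums (\<chi> i j. \<Sum>m. ?f m $ i $ j)"
    by (intro vec_sumsI) (use summable_sums[OF summable] in simp)
  then have "matrix_exp M = (\<chi> i j. \<Sum>m. ?f m $ i $ j)"
    unfolding matrix_exp_def by (rule sums_unique[symmetric])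
  then show ?thesis
    using summable_sums[OF summable, of u v] by (simp only: vec_lambda_beta)
qed

text \<open>Powers of \<open>M\<close> act on \<open>w\<close> as powers of \<open>c\<close>, so the
  matrix series applied to \<open>w\<close> becomes the scalar exponential series.\<close>

lemma matrix_exp_eigenvector:
  fixes M :: "complex ^ 'v::finite ^ 'v"
  assumes "M *v w = c *s w"
  shows "matrix_exp M *v w = exp c *s w"
proof -
  let ?P = "\<lambda>m. ((\<lambda>X. M ** X) ^^ m) (mat 1)"
  have P: "?P m *v w = c ^ m *s w" for m
    by (induction m)
      (simp_all add: matrix_vector_mul_assoc[symmetric] vec.scale assms mult.commute)
  have "(matrix_exp M *v w) $ u = exp c * w $ u" for u
  proof -
    have "(\<lambda>m. \<Sum>v\<in>UNIV. (?P m /\<^sub>R fact m) $ u $ v * w $ v) sums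
        (\<Sum>v\<in>UNIV. matrix_exp M $ u $ v * w $ v)"
      by (intro sums_sum sums_mult2 matrix_exp_entry_sums)
    moreover have "(\<Sum>v\<in>UNIV. (?P m /\<^sub>R fact m) $ u $ v * w $ v) = (c ^ m /\<^sub>R fact m) * w $ u" for m
      using P[of m] by (simp add: matrix_vector_mult_def vec_eq_iff scaleR_sum_right[symmetric])
    moreover have "(\<lambda>m. (c ^ m /\<^sub>R fact m) * w $ u) sums (exp c * w $ u)"
      by (intro sums_mult2 exp_converges)
    ultimately show ?thesis
      by (simp add: matrix_vector_mult_def sums_iff)
  qed
  then show ?thesis by (simp add: vec_eq_iff)
qed

section \<open>A spanning family of \<open>k\<close>-sets with a point of odd degree\<close>

text \<open>The family consists of all \<open>k\<close>-subsets of a set \<open>K\<close> of even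
  size \<open>k + 1\<close>, and of the sets \<open>insert i B\<close> for \<open>i\<close> outside
  \<open>K\<close>, with a fixed \<open>B\<close> of even size \<open>k - 1\<close> inside
  \<open>K\<close>. The former generate all even subsets of \<open>K\<close>, in particular
  \<open>K\<close> and \<open>B\<close>; the differences of \<open>K\<close> and
  \<open>K - {i}\<close>, and of \<open>insert i B\<close> and \<open>B\<close>, are then all
  singletons.\<close>

lemma ex_spanning_uniform_family:
  assumes "odd k" "k < CARD('n::finite)"
  obtains F :: "'n::finite set set" and j where
    "\<And>S. S \<in> F \<Longrightarrow> card S = k" "odd (card {S \<in> F. j \<in> S})"
    "\<And>G D. F \<subseteq> G \<Longrightarrow> (\<And>A B. A \<in> G \<Longrightarrow> B \<in> G \<Longrightarrow> sym_diff A B \<in> G) \<Longrightarrow> D \<in> G"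
proof -
  obtain K :: "'n set" where K: "card K = Suc k"
    using obtain_subset_with_card_n[of "Suc k" "UNIV :: 'n set"] assms(2) by (auto simp: Suc_le_eq)
  then obtain j where j: "j \<in> K" by fastforce
  then have "card (K - {j}) = k" using K by simp
  \<comment> \<open>As \<open>B\<close> avoids \<open>j\<close>, only the \<open>k\<close> sets
    \<open>K - {i}\<close> with \<open>i \<noteq> j\<close> contain \<open>j\<close>, and
    \<open>k\<close> is odd.\<close>
  then obtain B where B: "B \<subseteq> K - {j}" "card B = k - 1"
    using obtain_subset_with_card_n[of "k - 1" "K - {j}"] by auto
  let ?F = "(\<lambda>i. K - {i}) ` K \<union> (\<lambda>i. insert i B) ` (- K)"
  have card: "card S = k" if "S \<in> ?F" for S
  proof -
    have "card (insert i B) = k" if "i \<notin> K" for i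
      using that B odd_pos[OF assms(1)] by (subst card_insert_disjoint) auto
    then show ?thesis using that K by auto
  qed
  have "{S \<in> ?F. j \<in> S} = (\<lambda>i. K - {i}) ` (K - {j})"
    using B j by auto
  moreover have "inj_on (\<lambda>i. K - {i}) (K - {j})"
    by (auto simp: inj_on_def)
  ultimately have deg: "odd (card {S \<in> ?F. j \<in> S})"
    using assms(1) \<open>card (K - {j}) = k\<close> by (simp add: card_image)
  have span: "D \<in> G" if F: "?F \<subseteq> G" and G: "\<And>A B. A \<in> G \<Longrightarrow> B \<in> G \<Longrightarrow> sym_diff A B \<in> G" for G D
  proof -
    have co: "K - {i} \<in> G" if "i \<in> K" for i using that F by auto
    have empty: "{} \<in> G" using G[OF co[OF j] co[OF j]] by simp
    have pair: "sym_diff {a} {b} \<in> G" if "a \<in> K" "b \<in> K" for a b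
    proof -
      have "sym_diff {a} {b} = sym_diff (K - {a}) (K - {b})" using that by auto
      then show ?thesis using G[OF co co] that by simp
    qed
    \<comment> \<open>Odd sets are not yet known to lie in \<open>G\<close>; their differences with
      single points of \<open>K\<close> are even sets, which is enough to carry the induction
      through both parities.\<close>
    have parity: "(even (card S) \<longrightarrow> S \<in> G) \<and> (odd (card S) \<longrightarrow> (\<forall>a\<in>K. sym_diff S {a} \<in> G))"
      if "S \<subseteq> K" for S
      using finite[of S] that
    proof (induction S rule: finite_induct)
      case empty
      then show ?case using \<open>{} \<in> G\<close> by simp
    next
      case (insert s S)
      show ?case
      proof (cases "even (card S)")
        case True
        have "sym_diff (insert s S) {a} \<in> G" if "a \<in> K" for a
        proof -
          have "sym_diff (insert s S) {a} = sym_diff S (sym_diff {s} {a})"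
            using insert.hyps by auto
          then show ?thesis using True insert that G[of S "sym_diff {s} {a}"] pair[of s a] by simp
        qed
        then show ?thesis using True insert by simp
      next
        case False
        have "insert s S = sym_diff S {s}" using insert.hyps by auto
        moreover have "sym_diff S {s} \<in> G" using False insert by blast
        ultimately show ?thesis using False insert.hyps by simp
      qed
    qed
    have single: "{i} \<in> G" for i
    proof (cases "i \<in> K")
      case True
      then have "{i} = sym_diff K (K - {i})" by auto
      then show ?thesis using G[OF _ co[OF True], of K] parity[of K] K assms(1) by simp
    next
      case False
      then have "{i} = sym_diff (insert i B) B" using B by auto
      moreover have "insert i B \<in> G" using False F by auto
      moreover have "B \<in> G" using parity[of B] B assms(1) by auto
      ultimately show ?thesis using G[of "insert i B" B] by simp
    qed
    show "D \<in> G"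
      using finite[of D]
    proof (induction D rule: finite_induct)
      case empty
      then show ?case using \<open>{} \<in> G\<close> .
    next
      case (insert i D)
      have "insert i D = sym_diff D {i}" using insert.hyps by auto
      then show ?case using G[OF insert.IH single[of i]] by simp
    qed
  qed
  show thesis
    by (rule that[of ?F j]) (erule card, rule deg, rule span)
qed

section \<open>NEPS of paths\<close>

text \<open>The path is complete bipartite with parts \<open>{2}\<close> and \<open>{1, 3}\<close>,
  so only being the middle vertex matters.\<close>

lemma arcs_P3_iff: "(a, b) \<in> parcs P3 \<longleftrightarrow> (a = 2) \<noteq> (b = 2)"
  using exhaust_3[of a] exhaust_3[of b] by (elim disjE) (simp_all add: P3_def)

lemma pverts_P3 [simp]: "a \<in> pverts P3"
  using exhaust_3[of a] by (auto simp: P3_def)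

definition char_vec :: "'n set \<Rightarrow> 2 ^ 'n" where
  "char_vec S = (\<chi> i. if i \<in> S then 1 else 0)"

abbreviation P3_NEPS :: "'n set set \<Rightarrow> (3 ^ 'n) pair_pre_digraph" where
  "P3_NEPS F \<equiv> NEPS (\<lambda>_. P3) (char_vec ` F)"

lemma arcs_P3_NEPS_iff:
  "(x, y) \<in> parcs (P3_NEPS F) \<longleftrightarrow>
    (\<exists>S\<in>F. \<forall>i. if i \<in> S then (x $ i, y $ i) \<in> parcs P3 else x $ i = y $ i)"
  by (auto simp: NEPS_def char_vec_def split: if_splits)

lemma pverts_P3_NEPS [simp]: "x \<in> pverts (P3_NEPS F)"
  by (simp add: NEPS_def)

text \<open>Vertices with equal \<open>p\<close> are joined by moving there and back along members
  of \<open>F\<close>. Hence the sets \<open>D\<close> for which all \<open>x\<close>,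
  \<open>y\<close> with \<open>p y = sym_diff (p x) D\<close> are joined form a family that contains
  \<open>F\<close> and is closed under symmetric difference.\<close>

lemma P3_NEPS_reachable:
  fixes F :: "'n::finite set set"
  assumes span: "\<And>G D. F \<subseteq> G \<Longrightarrow> (\<And>A B. A \<in> G \<Longrightarrow> B \<in> G \<Longrightarrow> sym_diff A B \<in> G) \<Longrightarrow> D \<in> G"
  shows "(x, y) \<in> (parcs (P3_NEPS F))\<^sup>*"
proof -
  let ?R = "(parcs (P3_NEPS F))\<^sup>*"
  define p :: "3 ^ 'n \<Rightarrow> 'n set" where "p x = {i. x $ i = 2}" for x
  define flip :: "'n set \<Rightarrow> 3 ^ 'n \<Rightarrow> 3 ^ 'n"
    where "flip S x = (\<chi> i. if i \<in> S then (if x $ i = 2 then 1 else 2) else x $ i)" for S x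
  have p_flip: "p (flip S x) = sym_diff (p x) S" for S x
    by (auto simp: p_def flip_def)
  have to_flip: "(x, flip S x) \<in> ?R" if "S \<in> F" for S x
    using that by (intro r_into_rtrancl) (auto simp: arcs_P3_NEPS_iff arcs_P3_iff flip_def intro!: bexI[of _ S])
  \<comment> \<open>The way back need not end at the starting point: a coordinate moved to
    \<open>2\<close> may return to either of \<open>1\<close> and \<open>3\<close>.\<close>
  have from_flip: "(flip S x, y) \<in> ?R" if "S \<in> F" "p x = p y" "\<And>i. i \<notin> S \<Longrightarrow> x $ i = y $ i" for S x y
  proof -
    have "x $ i = 2 \<longleftrightarrow> y $ i = 2" for i using that(2) by (auto simp: p_def)
    then show ?thesis
      using that by (intro r_into_rtrancl)
        (auto simp: arcs_P3_NEPS_iff arcs_P3_iff flip_def intro!: bexI[of _ S])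
  qed
  \<comment> \<open>The sets avoiding \<open>i\<close> are closed under symmetric difference but do
    not include \<open>UNIV\<close>.\<close>
  have cover: "\<exists>S\<in>F. i \<in> S" for i
  proof (rule ccontr)
    assume "\<not> (\<exists>S\<in>F. i \<in> S)"
    then have "F \<subseteq> {D. i \<notin> D}" by auto
    then have "UNIV \<in> {D. i \<notin> D}" by (rule span) auto
    then show False by simp
  qed
  have same: "(x, y) \<in> ?R" if "p x = p y" for x y
    using that
  proof (induction "card {i. x $ i \<noteq> y $ i}" arbitrary: x rule: less_induct)
    case less
    show ?case
    proof (cases "x = y")
      case False
      then obtain i where i: "x $ i \<noteq> y $ i" by (auto simp: vec_eq_iff)
      obtain S where S: "S \<in> F" "i \<in> S" using cover by blast
      define z where "z = (\<chi> l. if l = i then y $ i else x $ l)"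
      have pz: "p x = p z" using less.prems by (auto simp: p_def z_def set_eq_iff)
      have "(x, z) \<in> ?R"
        using to_flip[OF S(1), of x] from_flip[OF S(1) pz] S(2) by (force simp: z_def)
      moreover have "{l. z $ l \<noteq> y $ l} = {l. x $ l \<noteq> y $ l} - {i}"
        by (auto simp: z_def)
      then have "card {l. z $ l \<noteq> y $ l} < card {l. x $ l \<noteq> y $ l}"
        using i by (simp only: card_Diff1_less finite mem_Collect_eq simp_thms)
      then have "(z, y) \<in> ?R"
        using less.hyps pz less.prems by simp
      ultimately show ?thesis by simp
    qed simp
  qed
  define G where "G = {D. \<forall>x y. p y = sym_diff (p x) D \<longrightarrow> (x, y) \<in> ?R}"
  have "sym_diff (p x) (p y) \<in> G"
  proof (rule span)
    show "F \<subseteq> G"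
      unfolding G_def
    proof (intro subsetI CollectI allI impI)
      fix D x y assume D: "D \<in> F" and y: "p y = sym_diff (p x) D"
      have "(flip D x, y) \<in> ?R" by (rule same) (simp only: y p_flip)
      with to_flip[OF D, of x] show "(x, y) \<in> ?R" by simp
    qed
    show "sym_diff A B \<in> G" if "A \<in> G" "B \<in> G" for A B
      unfolding G_def
    proof (intro CollectI allI impI)
      fix x y assume y: "p y = sym_diff (p x) (sym_diff A B)"
      have "(x, flip A x) \<in> ?R" using that(1) p_flip[of A x] by (simp only: G_def mem_Collect_eq)
      moreover have "p y = sym_diff (p (flip A x)) B" unfolding y p_flip by auto
      then have "(flip A x, y) \<in> ?R" using that(2) by (simp only: G_def mem_Collect_eq)
      ultimately show "(x, y) \<in> ?R" by simp
    qed
  qed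
  then have "\<forall>x' y'. p y' = sym_diff (p x') (sym_diff (p x) (p y)) \<longrightarrow> (x', y') \<in> ?R"
    by (simp only: G_def mem_Collect_eq)
  from this[THEN spec, of x, THEN spec, of y] show ?thesis
    by (rule mp) auto
qed

lemma connected_if_reachable:
  assumes "pverts G = UNIV" "\<And>u v. (u, v) \<in> (parcs G)\<^sup>*"
  shows "Digraph_Component.connected (with_proj G)"
proof -
  have "(u, v) \<in> rtrancl_on UNIV (parcs (mk_symmetric (with_proj G)))" for u v
    using assms(2)[of u v]
  proof (induction rule: rtrancl_induct)
    case (step v w)
    then have "(v, w) \<in> parcs (mk_symmetric (with_proj G))"
      by (force simp: parcs_mk_symmetric)
    with step.IH show ?case by (rule rtrancl_on_into_rtrancl_on) simp
  qed simp
  then show ?thesis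
    using assms(1) by (auto simp: Digraph_Component.connected_def strongly_connected_def reachable_def)
qed

section \<open>Product eigenvectors\<close>

text \<open>Unnormalised eigenvectors: listed at the vertices 1, 2, 3 they are (1,
  \<open>sqrt 2 * t\<close>, 1) for \<open>t\<close> = 1 or -1, and (1, 0, -1) for \<open>t\<close>
  = 0.\<close>

definition P3_vec :: "int \<Rightarrow> 3 \<Rightarrow> complex" where
  "P3_vec t a = (if a = 2 then complex_of_real (sqrt 2) * of_int t
    else if a = 1 \<or> t \<noteq> 0 then 1 else - 1)"

lemma P3_vec_eigenvector:
  assumes "t \<in> {-1, 0, 1}"
  shows "(\<Sum>b\<in>UNIV. adjacency_matrix P3 $ a $ b * P3_vec t b) = complex_of_real (sqrt 2) * of_int t * P3_vec t a"
proof -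
  obtain r where r: "complex_of_real (sqrt 2) = r" "r * r = 2"
    by (simp flip: of_real_mult)
  have "t = - 1 \<or> t = 0 \<or> t = 1" using assms by simp
  then show ?thesis
    using exhaust_3[of a]
    by (elim disjE) (simp_all add: sum_3 adjacency_matrix_def arcs_P3_iff P3_vec_def r)
qed

lemma sum_vec_prod:
  fixes h :: "'n::finite \<Rightarrow> 'a::finite \<Rightarrow> 'b::comm_semiring_1"
  shows "(\<Sum>y\<in>UNIV. \<Prod>i\<in>UNIV. h i (y $ i)) = (\<Prod>i\<in>UNIV. \<Sum>a\<in>UNIV. h i a)"
proof -
  have "(\<Sum>y\<in>UNIV. \<Prod>i\<in>UNIV. h i (y $ i)) = (\<Sum>g\<in>UNIV. \<Prod>i\<in>UNIV. h i (g i))"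
    by (rule sum.reindex_bij_witness[of _ vec_lambda vec_nth]) (simp_all add: vec_lambda_inverse)
  also have "\<dots> = (\<Prod>i\<in>UNIV. \<Sum>a\<in>UNIV. h i a)"
    by (subst prod_sum_PiE) (simp_all add: PiE_UNIV_domain)
  finally show ?thesis .
qed

text \<open>This is a sum of Kronecker products. No arc is counted twice: as \<open>P3\<close> has
  no loops, the only \<open>S\<close> that can witness an arc is the set of coordinates where
  \<open>x\<close> and \<open>y\<close> differ.\<close>

lemma adjacency_P3_NEPS:
  fixes F :: "'n::finite set set"
  shows "adjacency_matrix (P3_NEPS F) $ x $ y =
    (\<Sum>S\<in>F. \<Prod>i\<in>UNIV. if i \<in> S then adjacency_matrix P3 $ (x $ i) $ (y $ i) else mat 1 $ (x $ i) $ (y $ i))"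
    (is "_ = (\<Sum>S\<in>F. ?P S)")
proof -
  let ?Q = "\<lambda>S. \<forall>i. if i \<in> S then (x $ i, y $ i) \<in> parcs P3 else x $ i = y $ i"
  have P: "?P S = (if ?Q S then 1 else 0)" for S
  proof (cases "?Q S")
    case True
    then have "?P S = 1"
      by (intro prod.neutral) (auto simp: adjacency_matrix_def mat_def)
    with True show ?thesis by simp
  next
    case False
    then obtain i where i: "\<not> (if i \<in> S then (x $ i, y $ i) \<in> parcs P3 else x $ i = y $ i)" by blast
    then have "(if i \<in> S then adjacency_matrix P3 $ (x $ i) $ (y $ i) else mat 1 $ (x $ i) $ (y $ i)) = 0"
      by (cases "i \<in> S") (simp_all add: adjacency_matrix_def mat_def)
    then have "?P S = 0" by (intro prod_zero bexI[of _ i]) simp_all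
    with False show ?thesis by (simp only: if_False)
  qed
  have Q: "S = {i. x $ i \<noteq> y $ i}" if "?Q S" for S
  proof (rule set_eqI)
    show "i \<in> S \<longleftrightarrow> i \<in> {i. x $ i \<noteq> y $ i}" for i
      using that[THEN spec, of i] by (auto simp: arcs_P3_iff split: if_splits)
  qed
  show ?thesis
  proof (cases "\<exists>S\<in>F. ?Q S")
    case True
    then obtain S where S: "S \<in> F" "?Q S" by blast
    have "?Q T \<longleftrightarrow> T = S" for T
    proof
      show "T = S" if "?Q T" using Q[OF that] Q[OF S(2)] by (rule trans[OF _ sym])
      show "?Q T" if "T = S" unfolding that by (rule S(2))
    qed
    then have "?P T = (if T = S then 1 else 0)" for T unfolding P by simp
    then have "(\<Sum>T\<in>F. ?P T) = 1" using S(1) by simp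
    then show ?thesis using True by (simp add: adjacency_matrix_def arcs_P3_NEPS_iff)
  next
    case False
    then have "(\<Sum>T\<in>F. ?P T) = 0" unfolding P by (intro sum.neutral) auto
    then show ?thesis using False by (simp add: adjacency_matrix_def arcs_P3_NEPS_iff)
  qed
qed

text \<open>Each Kronecker summand acts coordinatewise on a product vector, with factor
  \<open>sqrt 2 * t i\<close> on \<open>S\<close> and 1 elsewhere. Since all \<open>S\<close> have
  size \<open>k\<close>, the power of \<open>sqrt 2\<close> is common to all summands.\<close>

lemma P3_NEPS_eigenvector:
  fixes F :: "'n::finite set set"
  assumes card: "\<And>S. S \<in> F \<Longrightarrow> card S = k" and t: "\<And>i. t i \<in> {-1, 0, 1}"
  shows "(\<Sum>y\<in>UNIV. adjacency_matrix (P3_NEPS F) $ x $ y * (\<Prod>i\<in>UNIV. P3_vec (t i) (y $ i))) =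
    complex_of_real (sqrt 2) ^ k * of_int (\<Sum>S\<in>F. \<Prod>i\<in>S. t i) * (\<Prod>i\<in>UNIV. P3_vec (t i) (x $ i))"
proof -
  let ?g = "\<lambda>S i. if i \<in> S then adjacency_matrix P3 else mat 1"
  have coord: "(\<Sum>b\<in>UNIV. ?g S i $ (x $ i) $ b * P3_vec (t i) b) =
      (if i \<in> S then complex_of_real (sqrt 2) * of_int (t i) else 1) * P3_vec (t i) (x $ i)" for S i
    using P3_vec_eigenvector[OF t] by (simp add: mat_def if_distrib[of "\<lambda>z. z * _"] cong: if_cong)
  have "(\<Sum>y\<in>UNIV. adjacency_matrix (P3_NEPS F) $ x $ y * (\<Prod>i\<in>UNIV. P3_vec (t i) (y $ i))) =
      (\<Sum>y\<in>UNIV. \<Sum>S\<in>F. \<Prod>i\<in>UNIV. ?g S i $ (x $ i) $ (y $ i) * P3_vec (t i) (y $ i))"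
    unfolding adjacency_P3_NEPS sum_distrib_right prod.distrib[symmetric]
    by (intro sum.cong prod.cong) auto
  also have "\<dots> = (\<Sum>S\<in>F. \<Sum>y\<in>UNIV. \<Prod>i\<in>UNIV. ?g S i $ (x $ i) $ (y $ i) * P3_vec (t i) (y $ i))"
    by (rule sum.swap)
  also have "\<dots> = (\<Sum>S\<in>F. \<Prod>i\<in>UNIV. (if i \<in> S then complex_of_real (sqrt 2) * of_int (t i) else 1) * P3_vec (t i) (x $ i))"
  proof (intro sum.cong refl)
    fix S
    show "(\<Sum>y\<in>UNIV. \<Prod>i\<in>UNIV. ?g S i $ (x $ i) $ (y $ i) * P3_vec (t i) (y $ i)) =
        (\<Prod>i\<in>UNIV. (if i \<in> S then complex_of_real (sqrt 2) * of_int (t i) else 1) * P3_vec (t i) (x $ i))"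
      unfolding sum_vec_prod[where h = "\<lambda>i b. ?g S i $ (x $ i) $ b * P3_vec (t i) b"] coord ..
  qed
  also have "\<dots> = (\<Sum>S\<in>F. complex_of_real (sqrt 2) ^ k * of_int (\<Prod>i\<in>S. t i) * (\<Prod>i\<in>UNIV. P3_vec (t i) (x $ i)))"
    by (intro sum.cong) (simp_all add: prod.distrib prod.If_cases card)
  finally show ?thesis
    by (simp add: sum_distrib_left sum_distrib_right)
qed

section \<open>State transfer\<close>

lemma exp_minus_i_pi_int: "exp (- \<i> * of_real pi * of_int m) = (if even m then 1 else - 1)"
proof -
  have "- \<i> * of_real pi * of_int m = \<i> * of_real (- (pi * of_int m))" by simp
  then have "exp (- \<i> * of_real pi * of_int m) = cis (- (pi * of_int m))"
    by (simp only: cis_conv_exp)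
  then show ?thesis by (simp add: complex_eq_iff cos_npi_int sin_npi_int)
qed

text \<open>Multiplying out the expansions of the \<open>h i\<close> writes the product vector as a
  combination of the eigenvectors \<open>?W t\<close>. The assumption \<open>parity\<close> gives
  all of them the same sign at this time, so linearity carries the sign over to the product.\<close>

lemma matrix_exp_P3_NEPS_product:
  fixes F :: "'n::finite set set"
  assumes card: "\<And>S. S \<in> F \<Longrightarrow> card S = k"
    and T: "\<And>i. T i \<subseteq> {-1, 0, 1}"
    and h: "\<And>i a. h i a = (\<Sum>t\<in>T i. c i t * P3_vec t a)"
    and parity: "\<And>t. (\<And>i. t i \<in> T i) \<Longrightarrow> even (card {S \<in> F. \<forall>i\<in>S. odd (t i)}) = b"
  shows "matrix_exp (\<chi> x y. - \<i> * complex_of_real (pi / sqrt 2 ^ k) * adjacency_matrix (P3_NEPS F) $ x $ y) *v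
      (\<chi> x. \<Prod>i\<in>UNIV. h i (x $ i)) = (if b then 1 else - 1) *s (\<chi> x. \<Prod>i\<in>UNIV. h i (x $ i))"
    (is "matrix_exp ?M *v ?h = ?e *s ?h")
proof -
  let ?W = "\<lambda>t. \<chi> x. \<Prod>i\<in>UNIV. P3_vec (t i) (x $ i)"
  have W: "matrix_exp ?M *v ?W t = ?e *s ?W t" if t: "\<And>i. t i \<in> T i" for t
  proof -
    let ?m = "\<Sum>S\<in>F. \<Prod>i\<in>S. t i"
    have t': "t i \<in> {-1, 0, 1}" for i using t T by blast
    have eig: "?M *v ?W t = (- \<i> * of_real pi * of_int ?m) *s ?W t"
    proof (rule vec_eq_iff[THEN iffD2, rule_format])
      fix x
      have "(?M *v ?W t) $ x = - \<i> * complex_of_real (pi / sqrt 2 ^ k) *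
          (\<Sum>y\<in>UNIV. adjacency_matrix (P3_NEPS F) $ x $ y * (\<Prod>i\<in>UNIV. P3_vec (t i) (y $ i)))"
        unfolding matrix_vector_mult_def by (simp only: vec_lambda_beta sum_distrib_left mult.assoc)
      also have "\<dots> = - \<i> * complex_of_real (pi / sqrt 2 ^ k) *
          (complex_of_real (sqrt 2) ^ k * of_int ?m * (\<Prod>i\<in>UNIV. P3_vec (t i) (x $ i)))"
        by (simp only: P3_NEPS_eigenvector[OF card t'])
      also have "\<dots> = ((- \<i> * of_real pi * of_int ?m) *s ?W t) $ x"
        by (simp del: of_int_sum of_int_prod add: field_simps)
      finally show "(?M *v ?W t) $ x = ((- \<i> * of_real pi * of_int ?m) *s ?W t) $ x" .
    qed
    \<comment> \<open>A product is odd iff all its factors are, and the parity of a sum is that of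
      the number of its odd terms.\<close>
    have "even ?m = b"
      using parity[OF t] by (simp add: even_sum_iff even_prod_iff)
    then show ?thesis
      using matrix_exp_eigenvector[OF eig] by (simp only: exp_minus_i_pi_int)
  qed
  have "?h = (\<Sum>t\<in>PiE UNIV T. (\<Prod>i\<in>UNIV. c i (t i)) *s ?W t)"
  proof (rule vec_eq_iff[THEN iffD2, rule_format])
    fix x
    have "finite (T i)" for i using finite_subset[OF T] by simp
    then have "?h $ x = (\<Sum>t\<in>PiE UNIV T. \<Prod>i\<in>UNIV. c i (t i) * P3_vec (t i) (x $ i))"
      unfolding h by (simp add: prod_sum_PiE)
    then show "?h $ x = (\<Sum>t\<in>PiE UNIV T. (\<Prod>i\<in>UNIV. c i (t i)) *s ?W t) $ x"
      by (simp add: sum_component prod.distrib)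
  qed
  moreover have "matrix_exp ?M *v (\<Sum>t\<in>PiE UNIV T. (\<Prod>i\<in>UNIV. c i (t i)) *s ?W t) =
      ?e *s (\<Sum>t\<in>PiE UNIV T. (\<Prod>i\<in>UNIV. c i (t i)) *s ?W t)"
    unfolding vec.linear_sum[OF matrix_vector_mul_linear_gen] vec.scale vec.scale_sum_right
    by (intro sum.cong refl) (subst W, auto simp: vec_eq_iff)
  ultimately show ?thesis by (simp only:)
qed

lemma P3_NEPS_state_transfer:
  fixes F :: "'n::finite set set"
  assumes card: "\<And>S. S \<in> F \<Longrightarrow> card S = k" and deg: "odd (card {S \<in> F. j \<in> S})"
  shows "perfect_state_transfer (P3_NEPS F) (\<chi> i. if i = j then 1 else 2) (\<chi> i. if i = j then 3 else 2)
    (pi / sqrt 2 ^ k)"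
proof -
  let ?u = "(\<chi> i. if i = j then 1 else 2) :: 3 ^ 'n" and ?v = "(\<chi> i. if i = j then 3 else 2) :: 3 ^ 'n"
  let ?E = "matrix_exp (\<chi> x y. - \<i> * complex_of_real (pi / sqrt 2 ^ k) * adjacency_matrix (P3_NEPS F) $ x $ y)"
  \<comment> \<open>The factor at \<open>j\<close> is (1, 0, \<open>s\<close>) and every other
    factor is the unit vector at 2, so that \<open>?h s\<close> is the unit vector at
    \<open>?u\<close> plus \<open>s\<close> times that at \<open>?v\<close>.\<close>
  define h where "h s i a = (if i = j then (if a = 1 then 1 else if a = 3 then s else 0)
      else if a = 2 then 1 else (0::complex))" for s i and a :: 3
  define e where "e b = (if b then 1 else - 1 :: complex)" for b
  let ?h = "\<lambda>s. \<chi> x. \<Prod>i\<in>UNIV. h s i (x $ i)"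
  have h_prod: "(\<Prod>i\<in>UNIV. h s i (x $ i)) = (if x = ?u then 1 else if x = ?v then s else 0)" for s x
  proof (cases "\<forall>i. i \<noteq> j \<longrightarrow> x $ i = 2")
    case True
    then have "(\<Prod>i\<in>UNIV. h s i (x $ i)) = (\<Prod>i\<in>UNIV. if i = j then h s j (x $ j) else 1)"
      by (intro prod.cong) (auto simp: h_def)
    also have "\<dots> = (if x = ?u then 1 else if x = ?v then s else 0)"
      using True by (auto simp: h_def vec_eq_iff)
    finally show ?thesis .
  next
    case False
    then obtain i where i: "i \<noteq> j" "x $ i \<noteq> 2" by blast
    then have "h s i (x $ i) = 0" by (simp add: h_def)
    then have "(\<Prod>i\<in>UNIV. h s i (x $ i)) = 0" by (intro prod_zero) auto
    then show ?thesis using i by (auto simp: vec_eq_iff)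
  qed
  have "?u \<noteq> ?v" by (auto simp: vec_eq_iff)
  have entries: "(?E *v ?h s) $ ?u = ?E $ ?u $ ?u + s * ?E $ ?u $ ?v" for s
  proof -
    have "(?E *v ?h s) $ ?u = (\<Sum>x\<in>UNIV. (if x = ?u then ?E $ ?u $ x else 0) + (if x = ?v then s * ?E $ ?u $ x else 0))"
      unfolding matrix_vector_mult_def vec_lambda_beta h_prod
      by (intro sum.cong) (use \<open>?u \<noteq> ?v\<close> in auto)
    then show ?thesis by (simp add: sum.distrib)
  qed
  have h2: "(\<Sum>t\<in>{-1, 1}. (of_int t / (2 * complex_of_real (sqrt 2))) * P3_vec t a) = (if a = 2 then 1 else 0)" for a
    using exhaust_3[of a] by (auto simp: P3_vec_def)
  \<comment> \<open>At \<open>j\<close>, (1, 0, 1) is half of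
    \<open>P3_vec 1 + P3_vec (- 1)\<close>; elsewhere \<open>h2\<close> applies. All
    \<open>t i\<close> are odd, so every member of \<open>F\<close> counts.\<close>
  have plus: "?E *v ?h 1 = e (even (card F)) *s ?h 1"
    unfolding e_def
  proof (rule matrix_exp_P3_NEPS_product[OF card,
      where T = "\<lambda>_. {-1, 1}" and c = "\<lambda>i t. if i = j then 1 / 2 else of_int t / (2 * complex_of_real (sqrt 2))"])
    show "h 1 i a = (\<Sum>t\<in>{-1, 1}. (if i = j then 1 / 2 else of_int t / (2 * complex_of_real (sqrt 2))) * P3_vec t a)" for i a
      using h2[of a] exhaust_3[of a] by (auto simp: h_def P3_vec_def)
    show "even (card {S \<in> F. \<forall>i\<in>S. odd (t i)}) = even (card F)" if "\<And>i. t i \<in> {-1, 1}" for t :: "'n \<Rightarrow> int"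
    proof -
      have "odd (t i)" for i using that[of i] by auto
      then show ?thesis by simp
    qed
  qed auto
  \<comment> \<open>At \<open>j\<close>, (1, 0, -1) is \<open>P3_vec 0\<close>, which removes
    exactly the members of \<open>F\<close> containing \<open>j\<close> from the count.\<close>
  have minus: "?E *v ?h (- 1) = e (even (card {S \<in> F. j \<notin> S})) *s ?h (- 1)"
    unfolding e_def
  proof (rule matrix_exp_P3_NEPS_product[OF card,
      where T = "\<lambda>i. if i = j then {0} else {-1, 1}" and c = "\<lambda>i t. if i = j then 1 else of_int t / (2 * complex_of_real (sqrt 2))"])
    show "h (- 1) i a = (\<Sum>t\<in>(if i = j then {0} else {-1, 1}).
        (if i = j then 1 else of_int t / (2 * complex_of_real (sqrt 2))) * P3_vec t a)" for i a
      using h2[of a] exhaust_3[of a] by (auto simp: h_def P3_vec_def)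
    show "even (card {S \<in> F. \<forall>i\<in>S. odd (t i)}) = even (card {S \<in> F. j \<notin> S})"
      if "\<And>i. t i \<in> (if i = j then {0} else {-1, 1})" for t :: "'n \<Rightarrow> int"
    proof -
      have "odd (t i) \<longleftrightarrow> i \<noteq> j" for i using that[of i] by (auto split: if_splits)
      then have "{S \<in> F. \<forall>i\<in>S. odd (t i)} = {S \<in> F. j \<notin> S}" by auto
      then show ?thesis by simp
    qed
  qed auto
  have "card F = card {S \<in> F. j \<in> S} + card {S \<in> F. j \<notin> S}"
    by (subst card_Un_disjoint[symmetric]) (auto intro: arg_cong[where f = card])
  then have sign: "e (even (card {S \<in> F. j \<notin> S})) = - e (even (card F))"
    using deg by (auto simp: e_def)
  \<comment> \<open>The \<open>?u\<close>-entries of \<open>plus\<close> and \<open>minus\<close>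
    give the sum and the difference of two entries of \<open>?E\<close>, with opposite values;
    subtracting isolates the entry at \<open>?u\<close>, \<open>?v\<close>.\<close>
  have "(?h s) $ ?u = 1" for s unfolding vec_lambda_beta h_prod by simp
  then have "?E $ ?u $ ?u + 1 * ?E $ ?u $ ?v = e (even (card F))"
      "?E $ ?u $ ?u + (- 1) * ?E $ ?u $ ?v = - e (even (card F))"
    using entries[of 1] entries[of "- 1"] unfolding plus minus sign vector_smult_component
    by simp_all
  moreover have "b = c" if "a + 1 * b = c" "a + (- 1) * b = - c" for a b c :: complex
  proof -
    have "2 * b = (a + 1 * b) - (a + (- 1) * b)" by simp
    then show ?thesis unfolding that by simp
  qed
  ultimately have "?E $ ?u $ ?v = e (even (card F))" by blast
  then show ?thesis
    unfolding perfect_state_transfer_def by (simp add: e_def)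
qed

theorem theorem4p11:
  fixes k :: nat
  assumes "CARD('n::finite) \<ge> 2"
    and "odd k"
    and "k < CARD('n)"
  shows "\<exists>\<Omega> :: (2 ^ 'n) set. 0 \<notin> \<Omega> \<and>
    Digraph_Component.connected (with_proj (NEPS (\<lambda>_ :: 'n. P3) \<Omega>)) \<and>
    (\<exists>u v. u \<noteq> v \<and>
      u \<in> pverts (NEPS (\<lambda>_ :: 'n. P3) \<Omega>) \<and> v \<in> pverts (NEPS (\<lambda>_ :: 'n. P3) \<Omega>) \<and>
      perfect_state_transfer (NEPS (\<lambda>_ :: 'n. P3) \<Omega>) u v (pi / sqrt 2 ^ k))"
proof (rule ex_spanning_uniform_family[OF assms(2,3)])
  fix F :: "'n set set" and j
  assume F: "\<And>S. S \<in> F \<Longrightarrow> card S = k" "odd (card {S \<in> F. j \<in> S})"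
    "\<And>G D. F \<subseteq> G \<Longrightarrow> (\<And>A B. A \<in> G \<Longrightarrow> B \<in> G \<Longrightarrow> sym_diff A B \<in> G) \<Longrightarrow> D \<in> G"
  let ?u = "(\<chi> i. if i = j then 1 else 2) :: 3 ^ 'n" and ?v = "(\<chi> i. if i = j then 3 else 2) :: 3 ^ 'n"
  \<comment> \<open>The zero tuple would be the indicator of the empty set, but members of
    \<open>F\<close> have odd size.\<close>
  have "0 \<notin> char_vec ` F"
  proof
    assume "0 \<in> char_vec ` F"
    then obtain S where S: "S \<in> F" "0 = char_vec S" by (rule imageE)
    have "i \<notin> S" for i
    proof -
      have "char_vec S $ i = 0" by (simp flip: S(2))
      then show ?thesis by (simp add: char_vec_def split: if_splits)
    qed
    then have "S = {}" by blast
    then show False using F(1)[OF S(1)] assms(2) by simp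
  qed
  moreover have "Digraph_Component.connected (with_proj (P3_NEPS F))"
  proof (rule connected_if_reachable)
    show "(u, v) \<in> (parcs (P3_NEPS F))\<^sup>*" for u v
      by (rule P3_NEPS_reachable) (rule F(3))
  qed auto
  moreover have "perfect_state_transfer (P3_NEPS F) ?u ?v (pi / sqrt 2 ^ k)"
    by (rule P3_NEPS_state_transfer[OF F(1,2)])
  moreover have "?u \<noteq> ?v" by (auto simp: vec_eq_iff)
  ultimately have "0 \<notin> char_vec ` F \<and> Digraph_Component.connected (with_proj (P3_NEPS F)) \<and>
      ?u \<noteq> ?v \<and> ?u \<in> pverts (P3_NEPS F) \<and> ?v \<in> pverts (P3_NEPS F) \<and>
      perfect_state_transfer (P3_NEPS F) ?u ?v (pi / sqrt 2 ^ k)"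
    by (intro conjI pverts_P3_NEPS)
  then show ?thesis by blast
qed

end
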